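(* Let $\mathcal{H}$ be a real Hilbert space, let $(x^k)_{k\in\mathbb{N}}$ be a sequence in $\mathcal{H}$ and let $M$ be a nonempty subset of $\mathcal{H}$. Suppose that $(x^k)_{k\in\mathbb{N}}$ is Fejér* monotone with respect to $M$. Then $(x^k)_{k\in\mathbb{N}}$ converges weakly to a point in $M$ if, and only if, $\mathfrak{W}(x^k)_{k\in\mathbb{N}}\subset M$.
   Context: $\mathbb{N}$ denotes the set of nonnegative integers. A sequence $(x^k)_{k\in\mathbb{N}}$ in a real Hilbert space $\mathcal{H}$ is Fejér* monotone with respect to a nonempty set $M\subset\mathcal{H}$ if for every $x\in M$ there exists $N(x)\in\mathbb{N}$ such that $\|x^{k+1}-x\|\le\|x^k-x\|$ for all $k\ge N(x)$. $\mathfrak{W}(x^k)_{k\in\mathbb{N}}$ denotes the set of weak cluster points of the sequence, i.e. the weak limits of its weakly convergent subsequences. *)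

theory Defs
  imports "HOL-Analysis.Analysis"
begin

text \<open>Weak convergence is convergence along every continuous linear functional. In a Hilbert
  space these are, by the Riesz representation theorem, exactly the maps
  \<open>\<lambda>v. v \<bullet> u\<close>.\<close>

definition weakly_convergent_to :: "(nat \<Rightarrow> 'a::real_normed_vector) \<Rightarrow> 'a \<Rightarrow> bool" where
  "weakly_convergent_to x l \<longleftrightarrow>
     (\<forall>f::'a \<Rightarrow> real. bounded_linear f \<longrightarrow> (\<lambda>k. f (x k)) \<longlonglongrightarrow> f l)"

definition weak_cluster_points :: "(nat \<Rightarrow> 'a::real_normed_vector) \<Rightarrow> 'a set" where
  "weak_cluster_points x =
     {l. \<exists>r::nat \<Rightarrow> nat. strict_mono r \<and> weakly_convergent_to (x \<circ> r) l}"

definition fejer_star_monotone :: "(nat \<Rightarrow> 'a::real_normed_vector) \<Rightarrow> 'a set \<Rightarrow> bool" where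
  "fejer_star_monotone x M \<longleftrightarrow>
     (\<forall>z\<in>M. \<exists>N. \<forall>k\<ge>N. norm (x (Suc k) - z) \<le> norm (x k - z))"

end

theory Submission
  imports Defs "HOL-Complex_Analysis.Great_Picard"
begin

text \<open>
  The proof is Opial's argument. For \<open>z \<in> M\<close> the distances \<open>norm (x k - z)\<close>
  eventually decrease, hence converge; the index from which they decrease depends on \<open>z\<close>,
  but convergence does not see it. One such \<open>z\<close> already bounds the sequence. Two of them,
  \<open>a\<close> and \<open>b\<close>, make \<open>x k \<bullet> (a - b)\<close> converge, because
  this inner product is, up to constants, the difference of two squared distances
  (\<open>fejer_star_monotone_inner_convergent\<close>). If \<open>a\<close> and \<open>b\<close> are moreover
  weak cluster points, then both \<open>a \<bullet> (a - b)\<close> and \<open>b \<bullet> (a - b)\<close>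
  equal that limit, so that \<open>(norm (a - b))\<^sup>2 = 0\<close>
  (\<open>weak_cluster_points_eqI\<close>). Consequently, if all weak cluster points lie in
  \<open>M\<close>, there is at most one of them. Weak sequential compactness of bounded sets
  (\<open>bounded_imp_weakly_convergent_subseq\<close>) supplies one, and applied to subsequences it
  forces the whole sequence to converge to it. Conversely, a weakly convergent sequence has its
  limit as only cluster point.

  Weak sequential compactness is obtained for an arbitrary, possibly nonseparable, Hilbert space
  by diagonalisation in the separable closed span of the sequence, combined with the Riesz
  representation theorem on closed subspaces (\<open>riesz_on_closed_subspace\<close>). The
  latter serves three times: applied to \<open>\<lambda>w. w \<bullet> v\<close> on a subspace it is
  orthogonal projection, on the whole space it turns the pointwise limit functional into a weak
  limit, and it replaces arbitrary functionals by inner products.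
\<close>

section \<open>Riesz representation\<close>

text \<open>The representing vector minimises the strictly convex functional
  \<open>v \<bullet> v - 2 * f v\<close> on the subspace. The parallelogram identity makes a minimising
  sequence Cauchy, and the vanishing of the first variation at the minimum is the claimed
  identity.\<close>

lemma riesz_on_closed_subspace:
  fixes S :: "'a::{real_inner, complete_space} set" and f :: "'a \<Rightarrow> real"
  assumes S: "subspace S" "closed S" and f: "bounded_linear f"
  obtains u where "u \<in> S" "\<And>v. v \<in> S \<Longrightarrow> f v = v \<bullet> u"
proof -
  interpret f: bounded_linear f by fact
  define J where "J v = v \<bullet> v - 2 * f v" for v
  define m where "m = Inf (J ` S)"
  obtain K where K: "\<And>v. norm (f v) \<le> norm v * K"
    using f.bounded by blast
  \<comment> \<open>complete the square: \<open>J v \<ge> (norm v - K)\<^sup>2 - K\<^sup>2\<close>\<close>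
  have J_lower: "- (K\<^sup>2) \<le> J v" for v
  proof -
    have "0 \<le> (norm v - K)\<^sup>2" by simp
    moreover have "f v \<le> norm v * K" using K[of v] by simp
    ultimately show ?thesis
      by (simp add: J_def power2_norm_eq_inner[symmetric] power2_diff)
  qed
  have m_le: "m \<le> J v" if "v \<in> S" for v
    unfolding m_def using that J_lower by (intro cInf_lower bdd_belowI2) auto
  have "\<exists>v\<in>S. J v < m + inverse (real (Suc n))" for n
    using cInf_lessD[of "J ` S" "m + inverse (real (Suc n))"] subspace_0[OF S(1)]
    by (auto simp: m_def)
  then obtain w where w: "\<And>n. w n \<in> S" "\<And>n. J (w n) < m + inverse (real (Suc n))"
    by metis
  \<comment> \<open>parallelogram identity: the linear part of \<open>J\<close> cancels, and the midpoint costs at least \<open>m\<close>\<close>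
  have gap: "(norm (a - b))\<^sup>2 \<le> 2 * (J a - m) + 2 * (J b - m)"
    if "a \<in> S" "b \<in> S" for a b
  proof -
    have "m \<le> J ((1/2) *\<^sub>R (a + b))"
      using S(1) that by (intro m_le subspace_scale subspace_add)
    moreover have "(norm (a - b))\<^sup>2 = 2 * J a + 2 * J b - 4 * J ((1/2) *\<^sub>R (a + b))"
      by (simp add: J_def power2_norm_eq_inner f.scaleR f.add inner_commute algebra_simps)
    ultimately show ?thesis by simp
  qed
  have "Cauchy w"
  proof (rule metric_CauchyI)
    fix e :: real assume e: "e > 0"
    obtain N where N: "inverse (real (Suc N)) < e\<^sup>2 / 4"
      using reals_Archimedean[of "e\<^sup>2 / 4"] e by auto
    have small: "J (w n) - m < e\<^sup>2 / 4" if "n \<ge> N" for n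
    proof -
      have "inverse (real (Suc n)) \<le> inverse (real (Suc N))" using that by simp
      with w(2)[of n] N show ?thesis by linarith
    qed
    have "dist (w i) (w j) < e" if "i \<ge> N" "j \<ge> N" for i j
    proof (rule power2_less_imp_less)
      have "(dist (w i) (w j))\<^sup>2 \<le> 2 * (J (w i) - m) + 2 * (J (w j) - m)"
        unfolding dist_norm by (intro gap w)
      also have "\<dots> < 2 * (e\<^sup>2 / 4) + 2 * (e\<^sup>2 / 4)"
        using that by (intro add_strict_mono mult_strict_left_mono small) auto
      finally show "(dist (w i) (w j))\<^sup>2 < e\<^sup>2" by simp
    qed (use e in simp)
    then show "\<exists>N. \<forall>i\<ge>N. \<forall>j\<ge>N. dist (w i) (w j) < e" by blast
  qed
  then obtain u where u: "w \<longlonglongrightarrow> u"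
    using Cauchy_convergent convergent_def by blast
  have uS: "u \<in> S"
    using closed_sequentially[OF S(2) w(1) u] .
  have "(\<lambda>n. J (w n)) \<longlonglongrightarrow> J u"
    unfolding J_def by (intro tendsto_intros f.tendsto u)
  moreover have "(\<lambda>n. m + inverse (real (Suc n))) \<longlonglongrightarrow> m"
    using tendsto_add[OF tendsto_const LIMSEQ_inverse_real_of_nat] by simp
  ultimately have Ju: "J u \<le> m"
    by (rule LIMSEQ_le) (use w(2) less_imp_le in blast)
  have "f v = v \<bullet> u" if v: "v \<in> S" for v
  proof (cases "v = 0")
    case False
    \<comment> \<open>\<open>t\<close> minimises the quadratic \<open>J (u + t *\<^sub>R v)\<close>, whose drop below \<open>J u\<close> is \<open>c\<^sup>2 / (v \<bullet> v)\<close>\<close>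
    define c where "c = f v - v \<bullet> u"
    define t where "t = c / (v \<bullet> v)"
    have "J u \<le> J (u + t *\<^sub>R v)"
      using Ju m_le[of "u + t *\<^sub>R v"] S(1) uS v
      by (meson order_trans subspace_add subspace_scale)
    also have "\<dots> = J u - 2 * t * c + t * t * (v \<bullet> v)"
      by (simp add: J_def c_def f.scaleR f.add inner_commute algebra_simps)
    also have "\<dots> = J u - c\<^sup>2 / (v \<bullet> v)"
      using False by (simp add: t_def power2_eq_square field_simps)
    finally have "c\<^sup>2 \<le> 0"
      using False inner_gt_zero_iff[of v]
      by (auto simp: divide_le_0_iff simp del: inner_gt_zero_iff)
    then show ?thesis by (simp add: c_def)
  qed (simp add: f.zero)
  with uS show ?thesis by (rule that)
qed

section \<open>Weak sequential compactness of bounded sets\<close>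

text \<open>Closedness is where boundedness of the sequence enters: the functionals
  \<open>\<lambda>v. y n \<bullet> v\<close> are then equicontinuous, so the Cauchy property passes to limits
  of vectors.\<close>

lemma closed_subspace_of_convergence:
  fixes y :: "nat \<Rightarrow> 'a::real_inner"
  assumes "\<And>n. norm (y n) \<le> B"
  shows "subspace {v. convergent (\<lambda>n. y n \<bullet> v)}" "closed {v. convergent (\<lambda>n. y n \<bullet> v)}"
proof -
  show "subspace {v. convergent (\<lambda>n. y n \<bullet> v)}"
    by (auto simp: subspace_def inner_add_right intro: convergent_add convergent_mult convergent_const)
  show "closed {v. convergent (\<lambda>n. y n \<bullet> v)}"
    unfolding closure_subset_eq[symmetric]
  proof (intro subsetI CollectI Cauchy_convergent metric_CauchyI)
    fix l and e :: real
    assume l: "l \<in> closure {v. convergent (\<lambda>n. y n \<bullet> v)}" and e: "e > 0"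
    have B: "B \<ge> 0" using assms[of 0] norm_ge_zero order_trans by blast
    obtain v where conv: "convergent (\<lambda>n. y n \<bullet> v)" and v: "dist v l < e / (3 * (B + 1))"
      using l e B unfolding closure_approachable
      by (metis (mono_tags, lifting) add_nonneg_pos divide_pos_pos mem_Collect_eq mult_pos_pos
          zero_less_numeral zero_less_one)
    \<comment> \<open>\<open>B + 1\<close> instead of \<open>B\<close> only avoids division by zero\<close>
    have close: "\<bar>y n \<bullet> v - y n \<bullet> l\<bar> < e / 3" for n
    proof -
      have "\<bar>y n \<bullet> v - y n \<bullet> l\<bar> \<le> norm (y n) * norm (v - l)"
        by (simp add: inner_diff_right[symmetric] Cauchy_Schwarz_ineq2)
      also have "\<dots> \<le> (B + 1) * norm (v - l)"
        using assms[of n] by (intro mult_right_mono) auto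
      also have "\<dots> < e / 3"
        using v B by (simp add: dist_norm field_simps)
      finally show ?thesis .
    qed
    obtain N where N: "\<And>i j. i \<ge> N \<Longrightarrow> j \<ge> N \<Longrightarrow> dist (y i \<bullet> v) (y j \<bullet> v) < e / 3"
      using metric_CauchyD[OF convergent_Cauchy[OF conv], of "e / 3"] e by auto
    have "dist (y i \<bullet> l) (y j \<bullet> l) < e" if "i \<ge> N" "j \<ge> N" for i j
      using N[OF that] close[of i] close[of j] unfolding dist_real_def by linarith
    then show "\<exists>N. \<forall>i\<ge>N. \<forall>j\<ge>N. dist (y i \<bullet> l) (y j \<bullet> l) < e" by blast
  qed
qed

lemma subspace_closure:
  fixes S :: "'a::real_normed_vector set"
  assumes "subspace S"
  shows "subspace (closure S)"
proof (rule subspaceI)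
  show "0 \<in> closure S"
    using subspace_0[OF assms] closure_subset by blast
next
  fix v w assume "v \<in> closure S" "w \<in> closure S"
  then obtain a b where "\<And>n. a n \<in> S" "a \<longlonglongrightarrow> v" "\<And>n. b n \<in> S" "b \<longlonglongrightarrow> w"
    by (auto simp: closure_sequential)
  then have "\<And>n. a n + b n \<in> S" "(\<lambda>n. a n + b n) \<longlonglongrightarrow> v + w"
    using assms by (auto intro: subspace_add tendsto_add)
  then show "v + w \<in> closure S"
    unfolding closure_sequential by (intro exI[of _ "\<lambda>n. a n + b n"]) auto
next
  fix c v assume "v \<in> closure S"
  then obtain a where "\<And>n. a n \<in> S" "a \<longlonglongrightarrow> v"
    by (auto simp: closure_sequential)
  then have "\<And>n. c *\<^sub>R a n \<in> S" "(\<lambda>n. c *\<^sub>R a n) \<longlonglongrightarrow> c *\<^sub>R v"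
    using assms by (auto intro: subspace_scale tendsto_scaleR)
  then show "c *\<^sub>R v \<in> closure S"
    unfolding closure_sequential by (intro exI[of _ "\<lambda>n. c *\<^sub>R a n"]) auto
qed

text \<open>A diagonal subsequence converges against each of the countably many vectors
  \<open>x j\<close>, hence against their closed span, and hence against every vector, since the
  component orthogonal to the span contributes nothing.\<close>

lemma bounded_imp_weakly_convergent_subseq:
  fixes x :: "nat \<Rightarrow> 'a::{real_inner, complete_space}"
  assumes "bounded (range x)"
  obtains r l where "strict_mono (r::nat \<Rightarrow> nat)" "weakly_convergent_to (x \<circ> r) l"
proof -
  obtain B where B: "\<And>n. norm (x n) \<le> B"
    using assms by (auto simp: bounded_iff)
  have bdd: "norm (x n \<bullet> v) \<le> B * norm v" for n v
    using Cauchy_Schwarz_ineq2[of "x n" v] mult_right_mono[OF B norm_ge_zero, of n v] by simp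
  obtain r where r: "strict_mono (r::nat \<Rightarrow> nat)"
    and conv0: "\<And>v. v \<in> range x \<Longrightarrow> \<exists>l. (\<lambda>n. x (r n) \<bullet> v) \<longlonglongrightarrow> l"
  proof (rule function_convergent_subsequence[of "range x" "\<lambda>n v. x n \<bullet> v" "B * B"])
    have "B \<ge> 0" using B[of 0] norm_ge_zero order_trans by blast
    then show "norm (x n \<bullet> v) \<le> B * B" if "v \<in> range x" for n v
      using that bdd[of n v] B by (auto intro: order_trans mult_left_mono)
  qed auto
  define S where "S = closure (span (range x))"
  have S: "subspace S" "closed S"
    by (simp_all add: S_def subspace_closure subspace_span)
  have xS: "x n \<in> S" for n
    unfolding S_def by (meson closure_subset rangeI span_base subsetD)
  define V where "V = {v. convergent (\<lambda>n. x (r n) \<bullet> v)}"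
  have V: "subspace V" "closed V"
    unfolding V_def by (rule closed_subspace_of_convergence, rule B)+
  have "S \<subseteq> V"
    unfolding S_def
  proof (intro closure_minimal span_minimal V)
    show "range x \<subseteq> V" using conv0 by (auto simp: V_def convergent_def)
  qed
  have conv: "convergent (\<lambda>n. x (r n) \<bullet> v)" for v
  proof -
    \<comment> \<open>\<open>p\<close> is the orthogonal projection of \<open>v\<close> onto \<open>S\<close>\<close>
    obtain p where p: "p \<in> S" "\<And>w. w \<in> S \<Longrightarrow> w \<bullet> v = w \<bullet> p"
      using riesz_on_closed_subspace[OF S bounded_linear_inner_left] by metis
    then show ?thesis using \<open>S \<subseteq> V\<close> xS by (auto simp: V_def)
  qed
  define L where "L v = lim (\<lambda>n. x (r n) \<bullet> v)" for v
  have L: "(\<lambda>n. x (r n) \<bullet> v) \<longlonglongrightarrow> L v" for v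
    using conv[of v] by (simp add: L_def convergent_LIMSEQ_iff)
  have "bounded_linear L"
  proof (rule bounded_linear_intro)
    show "L (v + w) = L v + L w" for v w
      using tendsto_add[OF L L] by (intro LIMSEQ_unique[OF L]) (simp add: inner_add_right)
    show "L (c *\<^sub>R v) = c *\<^sub>R L v" for c v
      using tendsto_mult_left[OF L] by (intro LIMSEQ_unique[OF L]) simp
    show "norm (L v) \<le> norm v * B" for v
      using tendsto_norm[OF L] by (rule LIMSEQ_le_const2) (use bdd in \<open>auto simp: mult.commute\<close>)
  qed
  then obtain l where l: "\<And>v. L v = v \<bullet> l"
    using riesz_on_closed_subspace[OF subspace_UNIV closed_UNIV] by (metis UNIV_I)
  have "weakly_convergent_to (x \<circ> r) l"
    unfolding weakly_convergent_to_def
  proof (intro allI impI)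
    fix f :: "'a \<Rightarrow> real" assume "bounded_linear f"
    then obtain u where "\<And>v. f v = v \<bullet> u"
      using riesz_on_closed_subspace[OF subspace_UNIV closed_UNIV] by (metis UNIV_I)
    then show "(\<lambda>k. f ((x \<circ> r) k)) \<longlonglongrightarrow> f l"
      using L[of u] by (simp add: l inner_commute)
  qed
  with r show ?thesis by (rule that)
qed

section \<open>Weak cluster points\<close>

lemma weakly_convergent_to_inner:
  fixes x :: "nat \<Rightarrow> 'a::real_inner"
  assumes "weakly_convergent_to x l"
  shows "(\<lambda>k. x k \<bullet> v) \<longlonglongrightarrow> l \<bullet> v"
  using assms bounded_linear_inner_left unfolding weakly_convergent_to_def by blast

text \<open>The only direction in which convergence has to be tested is \<open>a - b\<close> itself:
  along it, all weak cluster points have the same inner product.\<close>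

lemma weak_cluster_points_eqI:
  fixes x :: "nat \<Rightarrow> 'a::real_inner"
  assumes conv: "convergent (\<lambda>k. x k \<bullet> (a - b))"
    and a: "a \<in> weak_cluster_points x" and b: "b \<in> weak_cluster_points x"
  shows "a = b"
proof -
  from conv obtain c where c: "(\<lambda>k. x k \<bullet> (a - b)) \<longlonglongrightarrow> c" by (auto simp: convergent_def)
  have eq: "y \<bullet> (a - b) = c" if "y \<in> weak_cluster_points x" for y
  proof -
    from that obtain r :: "nat \<Rightarrow> nat" where r: "strict_mono r" "weakly_convergent_to (x \<circ> r) y"
      by (auto simp: weak_cluster_points_def)
    show ?thesis
      using weakly_convergent_to_inner[OF r(2), of "a - b"] LIMSEQ_subseq_LIMSEQ[OF c r(1)]
      by (auto intro: LIMSEQ_unique simp: o_def)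
  qed
  have "(a - b) \<bullet> (a - b) = 0"
    using eq[OF a] eq[OF b] by (simp add: inner_diff_left)
  then show ?thesis by simp
qed

text \<open>If a functional stayed away from its value at \<open>l\<close> along some subsequence, weak
  compactness would extract from it a further subsequence with a weak limit, which would be a
  cluster point other than \<open>l\<close>.\<close>

lemma weakly_convergent_to_unique_cluster_point:
  fixes x :: "nat \<Rightarrow> 'a::{real_inner, complete_space}"
  assumes "bounded (range x)" and only: "weak_cluster_points x \<subseteq> {l}"
  shows "weakly_convergent_to x l"
  unfolding weakly_convergent_to_def
proof (intro allI impI, rule ccontr)
  fix f :: "'a \<Rightarrow> real" assume f: "bounded_linear f" and "\<not> (\<lambda>k. f (x k)) \<longlonglongrightarrow> f l"
  then obtain e where e: "e > 0" "\<not> (\<forall>\<^sub>F k in sequentially. dist (f (x k)) (f l) < e)"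
    by (auto simp: tendsto_iff)
  define A where "A = {k. \<not> dist (f (x k)) (f l) < e}"
  have "infinite A"
    using e(2) by (auto simp: A_def frequently_cofinite[symmetric] cofinite_eq_sequentially not_eventually)
  then obtain s :: "nat \<Rightarrow> nat" where s: "strict_mono s" "\<And>k. s k \<in> A"
    using infinite_enumerate by blast
  have "bounded (range (x \<circ> s))"
    using assms(1) by (rule bounded_subset) auto
  then obtain r y where r: "strict_mono (r::nat \<Rightarrow> nat)" "weakly_convergent_to ((x \<circ> s) \<circ> r) y"
    by (rule bounded_imp_weakly_convergent_subseq)
  then have "y \<in> weak_cluster_points x"
    using strict_mono_o[OF s(1) r(1)] by (auto simp: weak_cluster_points_def o_assoc)
  with only have "y = l" by auto
  with r(2) f have "(\<lambda>k. f (x (s (r k)))) \<longlonglongrightarrow> f l"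
    by (simp add: weakly_convergent_to_def o_def)
  from tendstoD[OF this e(1)] obtain k where "dist (f (x (s (r k)))) (f l) < e"
    using eventually_happens'[OF sequentially_bot] by blast
  with s(2)[of "r k"] show False by (simp add: A_def)
qed

section \<open>Fejer* monotone sequences\<close>

lemma fejer_star_monotone_norm_convergent:
  assumes "fejer_star_monotone x M" "z \<in> M"
  shows "convergent (\<lambda>k. norm (x k - z))"
proof -
  obtain N where N: "\<And>k. k \<ge> N \<Longrightarrow> norm (x (Suc k) - z) \<le> norm (x k - z)"
    using assms by (auto simp: fejer_star_monotone_def)
  have "decseq (\<lambda>k. norm (x (k + N) - z))"
    using N by (intro decseq_SucI) simp
  then obtain d where "(\<lambda>k. norm (x (k + N) - z)) \<longlonglongrightarrow> d"
    by (rule decseq_convergent[of _ 0]) auto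
  then have "(\<lambda>k. norm (x k - z)) \<longlonglongrightarrow> d" by (rule LIMSEQ_offset)
  then show ?thesis by (rule convergentI)
qed

lemma fejer_star_monotone_bounded:
  assumes "fejer_star_monotone x M" "M \<noteq> {}"
  shows "bounded (range x)"
proof -
  obtain z where "z \<in> M" using assms(2) by blast
  then have "Bseq (\<lambda>k. norm (x k - z))"
    using assms(1) by (intro convergent_imp_Bseq fejer_star_monotone_norm_convergent)
  then have "bounded (range (\<lambda>k. x k - z))"
    by (simp add: Bseq_eq_bounded[symmetric] Bseq_def)
  then have "bounded ((+) z ` range (\<lambda>k. x k - z))" by (rule bounded_translation)
  then show ?thesis by (simp add: image_image)
qed

text \<open>Subtracting the expansions of the two squared distances cancels the uncontrolled term
  \<open>x k \<bullet> x k\<close>.\<close>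

lemma fejer_star_monotone_inner_convergent:
  fixes x :: "nat \<Rightarrow> 'a::real_inner"
  assumes x: "fejer_star_monotone x M" and "a \<in> M" "b \<in> M"
  shows "convergent (\<lambda>k. x k \<bullet> (a - b))"
proof -
  have "x k \<bullet> (a - b) =
      ((norm (x k - b))\<^sup>2 - (norm (x k - a))\<^sup>2 + (a \<bullet> a - b \<bullet> b)) * (1 / 2)" for k
    by (simp add: power2_norm_eq_inner inner_commute algebra_simps)
  moreover have "convergent
      (\<lambda>k. ((norm (x k - b))\<^sup>2 - (norm (x k - a))\<^sup>2 + (a \<bullet> a - b \<bullet> b)) * (1 / 2))"
    using assms unfolding power2_eq_square
    by (intro convergent_add convergent_diff convergent_mult convergent_const
        fejer_star_monotone_norm_convergent[OF x])
  ultimately show ?thesis by (simp only:)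
qed

theorem theorem4p5:
  fixes x :: "nat \<Rightarrow> 'a::{real_inner, complete_space}"
    and M :: "'a set"
  assumes "M \<noteq> {}"
    and "fejer_star_monotone x M"
  shows "(\<exists>l\<in>M. weakly_convergent_to x l) \<longleftrightarrow> weak_cluster_points x \<subseteq> M"
proof
  assume "\<exists>l\<in>M. weakly_convergent_to x l"
  then obtain l where l: "l \<in> M" "weakly_convergent_to x l" by blast
  have "l \<in> weak_cluster_points x"
    using l(2) by (auto simp: weak_cluster_points_def strict_mono_id intro!: exI[of _ id])
  moreover have "convergent (\<lambda>k. x k \<bullet> v)" for v
    using weakly_convergent_to_inner[OF l(2)] by (rule convergentI)
  ultimately show "weak_cluster_points x \<subseteq> M"
    using l(1) weak_cluster_points_eqI[of x] by blast
next
  assume sub: "weak_cluster_points x \<subseteq> M"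
  have bdd: "bounded (range x)"
    using assms(2,1) by (rule fejer_star_monotone_bounded)
  then obtain r l where "strict_mono (r::nat \<Rightarrow> nat)" "weakly_convergent_to (x \<circ> r) l"
    by (rule bounded_imp_weakly_convergent_subseq)
  then have l: "l \<in> weak_cluster_points x" by (auto simp: weak_cluster_points_def)
  have "weak_cluster_points x \<subseteq> {l}"
  proof
    fix y assume y: "y \<in> weak_cluster_points x"
    have "convergent (\<lambda>k. x k \<bullet> (y - l))"
      using assms(2) sub y l by (blast intro: fejer_star_monotone_inner_convergent)
    then show "y \<in> {l}" using weak_cluster_points_eqI[OF _ y l] by simp
  qed
  with bdd have "weakly_convergent_to x l" by (rule weakly_convergent_to_unique_cluster_point)
  with l sub show "\<exists>l\<in>M. weakly_convergent_to x l" by blast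
qed

end
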